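(* Let $x_1,x_2,x_3,x_4\in\mathbb R^3$ be the vertices of a trirectangular tetrahedron, i.e. the three face angles at the vertex $x_4$ are right angles. Then $\Re(D_4)\ge 64\prod_{1\le i<j\le 4}r_{ij}$; in particular the Atiyah–Sutcliffe Conjecture C2, $|D_4|\ge 64\prod_{1\le i<j\le 4}r_{ij}$, holds for trirectangular tetrahedra.
   Context: Put $d_3(a,b,c)=(a+b-c)(b+c-a)(c+a-b)$. For distinct points $x_1,\dots,x_4\in\mathbb R^3$ let $r_{ij}=|x_i-x_j|$, and let $V$ be the volume of the tetrahedron with these vertices ($V=0$ if coplanar). The (non-normalized) Atiyah determinant $D_4\in\mathbb C$ is defined as follows. Identify $S^2$ with $\mathbb{CP}^1=\mathbb C\cup\{\infty\}$ by stereographic projection, so that the antipode of $t$ is $-1/\bar t$. For $i\ne j$ let $t_{ij}$ be the point corresponding to the unit vector $(x_j-x_i)/r_{ij}$. For each pair $i<j$ choose a unit vector $(\alpha,\beta)\in\mathbb C^2$ such that $\ell_{ij}(t)=\alpha t+\beta$ has root $t_{ij}$ (with $\alpha=0$ if $t_{ij}=\infty$), and put $\ell_{ji}(t)=-\bar\beta t+\bar\alpha$ (which has root $t_{ji}$). Let $p_i(t)=\prod_{j\ne i}\ell_{ij}(t)=\sum_{j=1}^4 m_{ij}t^{j-1}$ and $D_4=64\prod_{1\le i<j\le4}r_{ij}\cdot\det(m_{ij})$; this does not depend on the choices. Known fact (Eastwood–Norbury): $$\Re(D_4)=64\prod_{i<j}r_{ij}-4d_3(r_{12}r_{34},r_{13}r_{24},r_{14}r_{23})+A_4+288V^2,$$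 $$A_4=\sum_{l=1}^4\Bigl(\sum_{i\ne l}r_{li}\bigl((r_{lj}+r_{lk})^2-r_{jk}^2\bigr)\Bigr)d_3(r_{ij},r_{ik},r_{jk}),\qquad \{j,k\}=\{1,2,3,4\}\setminus\{l,i\}.$$ *)

theory Defs
  imports "HOL-Analysis.Analysis" "Jordan_Normal_Form.Determinant"
begin

no_notation Matrix.vec_index (infixl \<open>$\<close> 100)
hide_const (open) Matrix.orthogonal Determinants.det

text \<open>
  The four points are \<open>x 1, x 2, x 3, x 4\<close>; other values of \<open>x\<close> are irrelevant.
  \<open>CP\<^sup>1\<close> is rendered as \<^typ>\<open>complex option\<close>, with \<^term>\<open>None\<close> the point at infinity.
  The projection is from the north pole, so antipodes are \<open>t\<close> and \<open>- 1 / cnj t\<close>.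
\<close>

definition stereo :: "real ^ 3 \<Rightarrow> complex option" where
  "stereo u =
     (if u $ 3 = 1 then None
      else Some (Complex (u $ 1) (u $ 2) / of_real (1 - u $ 3)))"

definition direction :: "(nat \<Rightarrow> real ^ 3) \<Rightarrow> nat \<Rightarrow> nat \<Rightarrow> real ^ 3" where
  "direction x i j = (x j - x i) /\<^sub>R dist (x i) (x j)"

definition form_root :: "complex \<Rightarrow> complex \<Rightarrow> complex option \<Rightarrow> bool" where
  "form_root \<alpha> \<beta> \<tau> \<longleftrightarrow> (case \<tau> of None \<Rightarrow> \<alpha> = 0 | Some t \<Rightarrow> \<alpha> * t + \<beta> = 0)"

text \<open>An admissible choice of the forms \<open>\<alpha> i j * t + \<beta> i j\<close>: free up to a phase for each
  \<open>i < j\<close>, and then determined for the reversed pairs.\<close>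

definition admissible_forms ::
  "(nat \<Rightarrow> real ^ 3) \<Rightarrow> (nat \<Rightarrow> nat \<Rightarrow> complex) \<Rightarrow> (nat \<Rightarrow> nat \<Rightarrow> complex) \<Rightarrow> bool" where
  "admissible_forms x \<alpha> \<beta> \<longleftrightarrow>
     (\<forall>i\<in>{1..4}. \<forall>j\<in>{1..4}. i < j \<longrightarrow>
        (cmod (\<alpha> i j))\<^sup>2 + (cmod (\<beta> i j))\<^sup>2 = 1 \<and>
        form_root (\<alpha> i j) (\<beta> i j) (stereo (direction x i j)) \<and>
        \<alpha> j i = - cnj (\<beta> i j) \<and> \<beta> j i = cnj (\<alpha> i j))"

definition atiyah_poly ::
  "(nat \<Rightarrow> nat \<Rightarrow> complex) \<Rightarrow> (nat \<Rightarrow> nat \<Rightarrow> complex) \<Rightarrow> nat \<Rightarrow> complex poly" where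
  "atiyah_poly \<alpha> \<beta> i = (\<Prod>j\<in>{1..4} - {i}. [:\<beta> i j, \<alpha> i j:])"

definition dist_prod :: "(nat \<Rightarrow> real ^ 3) \<Rightarrow> real" where
  "dist_prod x = (\<Prod>j\<in>{1..4}. \<Prod>i\<in>{1..<j}. dist (x i) (x j))"

text \<open>Matrix indices start at 0, so row \<open>i\<close> belongs to the point \<open>x (i + 1)\<close>.\<close>

definition atiyah_D4 ::
  "(nat \<Rightarrow> real ^ 3) \<Rightarrow> (nat \<Rightarrow> nat \<Rightarrow> complex) \<Rightarrow> (nat \<Rightarrow> nat \<Rightarrow> complex) \<Rightarrow> complex" where
  "atiyah_D4 x \<alpha> \<beta> =
     64 * of_real (dist_prod x) *
     det (mat 4 4 (\<lambda>(i, j). coeff (atiyah_poly \<alpha> \<beta> (i + 1)) j))"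

text \<open>For distinct points the orthogonality conditions already exclude coplanarity.\<close>

definition trirectangular :: "(nat \<Rightarrow> real ^ 3) \<Rightarrow> bool" where
  "trirectangular x \<longleftrightarrow> inj_on x {1..4} \<and>
     (\<forall>i\<in>{1..3}. \<forall>j\<in>{1..3}. i \<noteq> j \<longrightarrow> orthogonal (x i - x 4) (x j - x 4))"

lemma form_root_unit_exists:
  "\<exists>a b. (cmod a)\<^sup>2 + (cmod b)\<^sup>2 = 1 \<and> form_root a b \<tau>"
proof (cases \<tau>)
  case None
  then have "(cmod 0)\<^sup>2 + (cmod 1)\<^sup>2 = 1 \<and> form_root 0 1 \<tau>"
    by (simp add: form_root_def)
  then show ?thesis by blast
next
  case (Some t)
  define s where "s = sqrt (1 + (cmod t)\<^sup>2)"
  have s: "s > 0" "s\<^sup>2 = 1 + (cmod t)\<^sup>2"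
    unfolding s_def by (simp_all add: add_pos_nonneg)
  let ?a = "of_real (1 / s) :: complex" and ?b = "- of_real (1 / s) * t"
  have "cmod ?a = 1 / s" "cmod ?b = cmod t / s"
    using s(1) by (simp_all add: norm_mult norm_divide)
  then have "(cmod ?a)\<^sup>2 + (cmod ?b)\<^sup>2 = (1 + (cmod t)\<^sup>2) / s\<^sup>2"
    by (simp add: power_divide add_divide_distrib)
  also have "\<dots> = 1"
    using s by (metis divide_self_if less_irrefl power_not_zero)
  finally have "(cmod ?a)\<^sup>2 + (cmod ?b)\<^sup>2 = 1 \<and> form_root ?a ?b \<tau>"
    using Some by (simp add: form_root_def)
  then show ?thesis by blast
qed

lemma admissible_forms_exist: "\<exists>\<alpha> \<beta>. admissible_forms x \<alpha> \<beta>"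
proof -
  obtain a' b' where ab': "\<And>\<tau>. (cmod (a' \<tau>))\<^sup>2 + (cmod (b' \<tau>))\<^sup>2 = 1 \<and>
      form_root (a' \<tau>) (b' \<tau>) \<tau>"
    using form_root_unit_exists by metis
  define a where "a = (\<lambda>i j. a' (stereo (direction x i j)))"
  define b where "b = (\<lambda>i j. b' (stereo (direction x i j)))"
  have ab: "(cmod (a i j))\<^sup>2 + (cmod (b i j))\<^sup>2 = 1 \<and>
      form_root (a i j) (b i j) (stereo (direction x i j))" for i j
    using ab' by (simp add: a_def b_def)
  have "admissible_forms x (\<lambda>i j. if i < j then a i j else - cnj (b j i))
          (\<lambda>i j. if i < j then b i j else cnj (a j i))"
    unfolding admissible_forms_def using ab by auto
  then show ?thesis by blast
qed

end

theory Submission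
  imports Defs
begin

text \<open>
  A form \<open>w = (\<alpha>, \<beta>)\<close> of unit length whose root is the direction \<open>u\<close> satisfies
  \<open>2 w w\<^sup>* = 1 - u \<cdot> \<sigma>\<close>, where \<open>\<sigma>\<close> are the Pauli matrices. The determinant is invariant
  under \<open>SU(2)\<close>, which acts on the directions by rotations, so the three edges at \<open>x 4\<close> may be taken
  to lie along the coordinate axes, up to a reflection \<open>\<mu> = \<plusminus> \<i>\<close>. With \<open>a, b, c\<close> the
  lengths of these edges and \<open>p, q, r\<close> those of the hypotenuses, a direct evaluation gives
  \<open>Re D\<^sub>4 = 4 a b c S\<close> with \<open>S\<close> a cubic polynomial with nonnegative coefficients, and \<open>S \<ge> 16 p q r\<close> follows
  from the triangle inequalities \<open>p \<le> a + b\<close>, \<open>q \<le> a + c\<close>, \<open>r \<le> b + c\<close>.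
\<close>

section \<open>Explicit determinants and products of linear forms\<close>

text \<open>Laplace expansion along the first row. The minors are again written as
  \<open>mat\<close> of an index function, so the equation can be iterated by rewriting.\<close>

lemma det_mat_Suc:
  fixes f :: "nat \<times> nat \<Rightarrow> 'a :: comm_ring_1"
  shows "det (mat (Suc n) (Suc n) f) =
    (\<Sum>j<Suc n. f (0, j) * ((- 1) ^ j *
       det (mat n n (\<lambda>(i, k). f (Suc i, if k < j then k else Suc k)))))"
proof -
  have "mat_delete (mat (Suc n) (Suc n) f) 0 j =
      mat n n (\<lambda>(i, k). f (Suc i, if k < j then k else Suc k))" for j
    by (rule eq_matI) (auto simp: mat_delete_def)
  then show ?thesis
    by (subst laplace_expansion_row[where i = 0 and n = "Suc n"]) (auto simp: cofactor_def intro!: sum.cong)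
qed

text \<open>Laplace expansion along the first two rows: each 2x2 minor of rows 0 and 1 is paired
  with the complementary minor of rows 2 and 3.\<close>

lemma det_mat_4:
  fixes f :: "nat \<times> nat \<Rightarrow> 'a :: comm_ring_1"
  shows "det (mat 4 4 f) =
     (f (0,0) * f (1,1) - f (0,1) * f (1,0)) * (f (2,2) * f (3,3) - f (2,3) * f (3,2))
   - (f (0,0) * f (1,2) - f (0,2) * f (1,0)) * (f (2,1) * f (3,3) - f (2,3) * f (3,1))
   + (f (0,0) * f (1,3) - f (0,3) * f (1,0)) * (f (2,1) * f (3,2) - f (2,2) * f (3,1))
   + (f (0,1) * f (1,2) - f (0,2) * f (1,1)) * (f (2,0) * f (3,3) - f (2,3) * f (3,0))
   - (f (0,1) * f (1,3) - f (0,3) * f (1,1)) * (f (2,0) * f (3,2) - f (2,2) * f (3,0))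
   + (f (0,2) * f (1,3) - f (0,3) * f (1,2)) * (f (2,0) * f (3,1) - f (2,1) * f (3,0))"
proof -
  have *: "mat 4 4 f = mat (Suc (Suc (Suc (Suc 0)))) (Suc (Suc (Suc (Suc 0)))) f"
    by (simp add: numeral_eq_Suc)
  show ?thesis
    unfolding * by (simp only: det_mat_Suc lessThan_Suc) (simp add: numeral_eq_Suc algebra_simps)
qed

lemma coeff_cubic:
  fixes a1 b1 a2 b2 a3 b3 :: complex
  defines "p \<equiv> [:b1, a1:] * [:b2, a2:] * [:b3, a3:]"
  shows "coeff p 0 = b1 * b2 * b3"
    "coeff p 1 = a1 * b2 * b3 + b1 * a2 * b3 + b1 * b2 * a3"
    "coeff p 2 = a1 * a2 * b3 + a1 * b2 * a3 + b1 * a2 * a3"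
    "coeff p 3 = a1 * a2 * a3"
  unfolding p_def by (simp_all add: numeral_eq_Suc algebra_simps)

lemma minus_1_to_4:
  "{1..4} - {1} = {2, 3, 4::nat}" "{1..4} - {2} = {1, 3, 4::nat}"
  "{1..4} - {3} = {1, 2, 4::nat}" "{1..4} - {4} = {1, 2, 3::nat}"
  by auto

lemma atiyah_poly_simps:
  "atiyah_poly \<alpha> \<beta> 1 = [:\<beta> 1 2, \<alpha> 1 2:] * [:\<beta> 1 3, \<alpha> 1 3:] * [:\<beta> 1 4, \<alpha> 1 4:]"
  "atiyah_poly \<alpha> \<beta> 2 = [:\<beta> 2 1, \<alpha> 2 1:] * [:\<beta> 2 3, \<alpha> 2 3:] * [:\<beta> 2 4, \<alpha> 2 4:]"
  "atiyah_poly \<alpha> \<beta> 3 = [:\<beta> 3 1, \<alpha> 3 1:] * [:\<beta> 3 2, \<alpha> 3 2:] * [:\<beta> 3 4, \<alpha> 3 4:]"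
  "atiyah_poly \<alpha> \<beta> 4 = [:\<beta> 4 1, \<alpha> 4 1:] * [:\<beta> 4 2, \<alpha> 4 2:] * [:\<beta> 4 3, \<alpha> 4 3:]"
  unfolding atiyah_poly_def minus_1_to_4
  by (simp_all add: mult.assoc del: mult_pCons_left mult_pCons_right One_nat_def)

section \<open>Linear substitutions acting on cubics\<close>

text \<open>Third symmetric power of the 2x2 matrix with rows \<open>(g, h)\<close> and
  \<open>(g', h')\<close>, acting on cubics in one variable; the exponent \<open>3 - m\<close> comes
  from homogenising.\<close>

definition sym_cube :: "complex \<Rightarrow> complex \<Rightarrow> complex \<Rightarrow> complex \<Rightarrow> complex mat" where
  "sym_cube g h g' h' = mat 4 4 (\<lambda>(m, j). coeff ([:h, g:] ^ m * [:h', g':] ^ (3 - m)) j)"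

text \<open>The exponent is 0 + 1 + 2 + 3 = 6, as one sees on diagonal matrices.\<close>

lemma det_sym_cube: "det (sym_cube g h g' h') = (g * h' - h * g') ^ 6"
  unfolding sym_cube_def det_mat_4
  by (simp add: numeral_eq_Suc algebra_simps)

text \<open>Each factor is \<open>y P + z Q\<close> with P = \<open>g t + h\<close> and Q =
  \<open>g' t + h'\<close>. Multiplying out in P and Q gives the same coefficients as for the
  factors \<open>y t + z\<close>.\<close>

lemma coeff_cubic_change_basis:
  assumes "j < 4"
  shows "coeff ([:y1 * h + z1 * h', y1 * g + z1 * g':] * [:y2 * h + z2 * h', y2 * g + z2 * g':]
                * [:y3 * h + z3 * h', y3 * g + z3 * g':]) j
    = (\<Sum>m<4. coeff ([:z1, y1:] * [:z2, y2:] * [:z3, y3:]) m * coeff ([:h, g:] ^ m * [:h', g':] ^ (3 - m)) j)"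
proof -
  have "j \<in> {0,1,2,3}" using assms by auto
  then show ?thesis
    by (auto simp: numeral_eq_Suc algebra_simps)
qed


section \<open>Unit forms as projectors, and rotated frames\<close>

text \<open>The root fixes the ratio of \<open>\<alpha>\<close> and \<open>\<beta>\<close> and the
  norm fixes their size; the remaining phase cancels in products with conjugates.\<close>

lemma form_projector:
  fixes u :: "real ^ 3"
  assumes u: "norm u = 1" and n: "(cmod \<alpha>)\<^sup>2 + (cmod \<beta>)\<^sup>2 = 1"
    and root: "form_root \<alpha> \<beta> (stereo u)"
  shows "2 * (\<alpha> * cnj \<alpha>) = 1 - of_real (u $ 3)"
    "2 * (\<beta> * cnj \<beta>) = 1 + of_real (u $ 3)"
    "2 * (\<beta> * cnj \<alpha>) = - Complex (u $ 1) (u $ 2)"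
proof -
  have uu: "(u $ 1)\<^sup>2 + (u $ 2)\<^sup>2 + (u $ 3)\<^sup>2 = 1"
    using u by (simp add: norm_eq_1 inner_vec_def sum_3 power2_eq_square)
  have n': "\<alpha> * cnj \<alpha> + \<beta> * cnj \<beta> = 1"
    using n by (simp only: complex_norm_square[symmetric] of_real_add[symmetric] of_real_1)
  have "2 * (\<alpha> * cnj \<alpha>) = 1 - of_real (u $ 3) \<and> 2 * (\<beta> * cnj \<alpha>) = - Complex (u $ 1) (u $ 2)"
  proof (cases "u $ 3 = 1")
    case True
    then have "u $ 1 = 0" "u $ 2 = 0" using uu by (simp_all add: sum_power2_eq_zero_iff)
    moreover have "\<alpha> = 0" using root True by (simp add: form_root_def stereo_def)
    ultimately show ?thesis using True by (simp add: complex_eq_iff)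
  next
    case False
    define w where "w = Complex (u $ 1) (u $ 2)"
    define s where "s = complex_of_real (1 - u $ 3)"
    have s: "s \<noteq> 0" "cnj s = s" using False by (simp_all add: s_def)
    \<comment> \<open>On the unit sphere the squared modulus of \<open>w\<close> is (1 - u3)(1 +
      u3).\<close>
    have ww: "w * cnj w = s * (2 - s)"
      using uu by (simp add: w_def s_def complex_eq_iff power2_eq_square algebra_simps)
    have "\<alpha> * (w / s) + \<beta> = 0"
      using root False by (simp add: form_root_def stereo_def w_def s_def)
    then have \<beta>: "s * \<beta> = - \<alpha> * w" using s by (simp add: field_simps eq_neg_iff_add_eq_0)
    then have \<beta>': "s * cnj \<beta> = - cnj \<alpha> * cnj w"
      using s(2) by (metis complex_cnj_minus complex_cnj_mult)
    have "s * (2 * (\<alpha> * cnj \<alpha>)) = s * s * (\<alpha> * cnj \<alpha>) + (\<alpha> * cnj \<alpha>) * (w * cnj w)"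
      unfolding ww by (simp add: algebra_simps)
    also have "\<dots> = s * s * (\<alpha> * cnj \<alpha>) + (s * \<beta>) * (s * cnj \<beta>)"
      unfolding \<beta> \<beta>' by (simp add: algebra_simps)
    also have "\<dots> = s * s * (\<alpha> * cnj \<alpha> + \<beta> * cnj \<beta>)"
      by (simp add: algebra_simps)
    finally have "s * (2 * (\<alpha> * cnj \<alpha>)) = s * s" by (simp add: n')
    then have 1: "2 * (\<alpha> * cnj \<alpha>) = s" using s by simp
    have "s * (2 * (\<beta> * cnj \<alpha>)) = 2 * (s * \<beta>) * cnj \<alpha>" by simp
    also have "\<dots> = 2 * (\<alpha> * cnj \<alpha>) * - w" unfolding \<beta> by simp
    finally have "s * (2 * (\<beta> * cnj \<alpha>)) = s * - w" unfolding 1 .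
    then have "2 * (\<beta> * cnj \<alpha>) = - w" using s(1) by (simp only: mult_cancel_left) simp
    with 1 show ?thesis by (simp add: s_def w_def)
  qed
  then show "2 * (\<alpha> * cnj \<alpha>) = 1 - of_real (u $ 3)" "2 * (\<beta> * cnj \<alpha>) = - Complex (u $ 1) (u $ 2)"
    by blast+
  moreover have "2 * (\<beta> * cnj \<beta>) = 2 * (\<alpha> * cnj \<alpha> + \<beta> * cnj \<beta>) - 2 * (\<alpha> * cnj \<alpha>)"
    by (simp add: algebra_simps)
  ultimately show "2 * (\<beta> * cnj \<beta>) = 1 + of_real (u $ 3)"
    by (simp add: n')
qed

text \<open>
  Components of \<open>d\<close> in the frame rotated by the element of \<open>SU(2)\<close> with rows \<open>(g, h)\<close> and
  \<open>(- cnj h, cnj g)\<close>: \<open>height\<close> along the third axis, \<open>planar\<close> the other two as a complex number.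
  They are the matrix entries of \<open>d \<cdot> \<sigma>\<close> in the basis formed by these rows.
\<close>

definition planar :: "complex \<Rightarrow> complex \<Rightarrow> real ^ 3 \<Rightarrow> complex" where
  "planar g h d = g\<^sup>2 * Complex (d $ 1) (d $ 2) - h\<^sup>2 * cnj (Complex (d $ 1) (d $ 2))
     - 2 * g * h * of_real (d $ 3)"

definition height :: "complex \<Rightarrow> complex \<Rightarrow> real ^ 3 \<Rightarrow> real" where
  "height g h d = d $ 3 * ((cmod g)\<^sup>2 - (cmod h)\<^sup>2) + 2 * Re (g * cnj h * Complex (d $ 1) (d $ 2))"

lemma of_real_height:
  "of_real (height g h d) = of_real (d $ 3) * (g * cnj g - h * cnj h)
     + g * cnj h * Complex (d $ 1) (d $ 2) + cnj g * h * cnj (Complex (d $ 1) (d $ 2))"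
proof -
  have "of_real (2 * Re z) = z + cnj z" for z by (simp add: complex_add_cnj)
  from this[of "g * cnj h * Complex (d $ 1) (d $ 2)"] show ?thesis
    unfolding height_def
    by (simp only: of_real_add of_real_mult of_real_diff complex_norm_square of_real_numeral) (simp only: complex_cnj_mult complex_cnj_cnj add.assoc)
qed

lemma height_diff: "height g h (d - e) = height g h d - height g h e"
  by (simp add: height_def algebra_simps)

lemma planar_diff: "planar g h (d - e) = planar g h d - planar g h e"
  by (simp add: planar_def algebra_simps complex_eq_iff)

text \<open>A unit pair \<open>(g, h)\<close> acts as a rotation, so the rotated components compute
  the same inner product.\<close>

lemma inner_height_planar:
  assumes gh: "g * cnj g + h * cnj h = 1"
  shows "inner d e = height g h d * height g h e + Re (planar g h d * cnj (planar g h e))"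
proof -
  define W V t s where "W = Complex (d $ 1) (d $ 2)" "V = Complex (e $ 1) (e $ 2)"
    "t = complex_of_real (d $ 3)" "s = complex_of_real (e $ 3)"
  note defs = this
  have "2 * of_real (inner d e) = 2 * t * s + W * cnj V + cnj W * V"
    by (simp add: defs inner_vec_def sum_3 complex_eq_iff algebra_simps)
  \<comment> \<open>Inserting the square of 1 makes both sides homogeneous of the same degree in
    \<open>g\<close>, \<open>h\<close> and their conjugates; what remains is a polynomial
    identity.\<close>
  also have "\<dots> = (g * cnj g + h * cnj h)\<^sup>2 * (2 * t * s + W * cnj V + cnj W * V)"
    using gh by simp
  also have "\<dots> = 2 * (of_real (height g h d) * of_real (height g h e))
      + (planar g h d * cnj (planar g h e) + cnj (planar g h d * cnj (planar g h e)))"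
    unfolding of_real_height planar_def defs[symmetric]
    by (simp add: defs(3,4)) (simp add: algebra_simps power2_eq_square)
  also have "\<dots> = 2 * of_real (height g h d * height g h e + Re (planar g h d * cnj (planar g h e)))"
    by (subst complex_add_cnj) simp
  finally show ?thesis
    by (simp only: mult_cancel_left of_real_eq_iff) simp
qed

section \<open>Behaviour of the determinant under basis change and rescaling\<close>

text \<open>The indices are chosen before \<open>\<alpha>\<close> and \<open>\<beta>\<close>, so two
  families of forms can be compared factor by factor.\<close>

lemma atiyah_poly_cubic:
  assumes "i \<in> {1..4}"
  shows "\<exists>k l m. {k, l, m} \<subseteq> {1..4} - {i} \<and> (\<forall>\<alpha> \<beta>.
    atiyah_poly \<alpha> \<beta> i = [:\<beta> i k, \<alpha> i k:] * [:\<beta> i l, \<alpha> i l:] * [:\<beta> i m, \<alpha> i m:])"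
proof -
  have "card ({1..4} - {i}) = 3" using assms by simp
  then obtain k l m where klm: "{1..4} - {i} = {k, l, m}" "k \<noteq> l" "l \<noteq> m" "k \<noteq> m"
    by (auto simp: card_3_iff)
  have "atiyah_poly \<alpha> \<beta> i = [:\<beta> i k, \<alpha> i k:] * [:\<beta> i l, \<alpha> i l:] * [:\<beta> i m, \<alpha> i m:]" for \<alpha> \<beta>
    unfolding atiyah_poly_def klm(1)
    using klm(2-4) by (simp add: mult.assoc del: mult_pCons_left mult_pCons_right)
  with klm(1) show ?thesis by blast
qed

text \<open>The substitution multiplies the coefficient matrix on the right by
  \<open>sym_cube\<close>, whose determinant is 1 for a unimodular basis.\<close>

lemma atiyah_det_change_basis:
  assumes "\<And>i j. i \<in> {1..4} \<Longrightarrow> j \<in> {1..4} \<Longrightarrow> i \<noteq> j \<Longrightarrow>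
      \<alpha> i j = y i j * g + z i j * g' \<and> \<beta> i j = y i j * h + z i j * h'"
    and "g * h' - h * g' = 1"
  shows "det (mat 4 4 (\<lambda>(i, j). coeff (atiyah_poly \<alpha> \<beta> (i + 1)) j)) =
    det (mat 4 4 (\<lambda>(i, j). coeff (atiyah_poly y z (i + 1)) j))"
proof -
  have row: "coeff (atiyah_poly \<alpha> \<beta> (i + 1)) j =
      (\<Sum>m<4. coeff (atiyah_poly y z (i + 1)) m * coeff ([:h, g:] ^ m * [:h', g':] ^ (3 - m)) j)"
    if "i < 4" "j < 4" for i j
  proof -
    have "i + 1 \<in> {1..4}" using \<open>i < 4\<close> by simp
    then obtain k l m where klm: "{k, l, m} \<subseteq> {1..4} - {i + 1}"
      and poly: "\<forall>\<alpha> \<beta>. atiyah_poly \<alpha> \<beta> (i + 1) =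
        [:\<beta> (i + 1) k, \<alpha> (i + 1) k:] * [:\<beta> (i + 1) l, \<alpha> (i + 1) l:] * [:\<beta> (i + 1) m, \<alpha> (i + 1) m:]"
      using atiyah_poly_cubic by blast
    have *: "\<alpha> (i + 1) n = y (i + 1) n * g + z (i + 1) n * g' \<and>
        \<beta> (i + 1) n = y (i + 1) n * h + z (i + 1) n * h'" if "n \<in> {k, l, m}" for n
      using assms(1)[of "i + 1" n] klm that \<open>i < 4\<close> by auto
    have "coeff (atiyah_poly \<alpha> \<beta> (i + 1)) j =
      coeff ([:y (i + 1) k * h + z (i + 1) k * h', y (i + 1) k * g + z (i + 1) k * g':]
        * [:y (i + 1) l * h + z (i + 1) l * h', y (i + 1) l * g + z (i + 1) l * g':]
        * [:y (i + 1) m * h + z (i + 1) m * h', y (i + 1) m * g + z (i + 1) m * g':]) j"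
      unfolding poly[rule_format] using *[of k] *[of l] *[of m] by simp
    then show ?thesis
      unfolding poly[rule_format] coeff_cubic_change_basis[OF \<open>j < 4\<close>] .
  qed
  have "mat 4 4 (\<lambda>(i, j). coeff (atiyah_poly \<alpha> \<beta> (i + 1)) j) =
    mat 4 4 (\<lambda>(i, j). coeff (atiyah_poly y z (i + 1)) j) * sym_cube g h g' h'"
    by (rule eq_matI) (auto simp: row[simplified] sym_cube_def scalar_prod_def lessThan_atLeast0 intro!: sum.cong)
  then show ?thesis
    using assms(2) by (simp add: det_mult[where n = 4] sym_cube_def det_sym_cube[unfolded sym_cube_def])
qed

text \<open>Row \<open>i\<close> is multilinear in its three forms. This serves to strip phases and
  normalising factors from the forms.\<close>

lemma atiyah_det_scale:
  assumes "\<And>i j. i \<in> {1..4} \<Longrightarrow> j \<in> {1..4} \<Longrightarrow> i \<noteq> j \<Longrightarrow>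
      \<alpha> i j = c i j * y i j \<and> \<beta> i j = c i j * z i j"
  shows "det (mat 4 4 (\<lambda>(i, j). coeff (atiyah_poly \<alpha> \<beta> (i + 1)) j)) =
    (\<Prod>i\<in>{1..4}. \<Prod>j\<in>{1..4} - {i}. c i j) *
    det (mat 4 4 (\<lambda>(i, j). coeff (atiyah_poly y z (i + 1)) j))"
proof -
  define s where "s i = (\<Prod>j\<in>{1..4} - {i}. c i j)" for i
  have row: "atiyah_poly \<alpha> \<beta> i = Polynomial.smult (s i) (atiyah_poly y z i)" if "i \<in> {1..4}" for i
  proof -
    have "atiyah_poly \<alpha> \<beta> i = (\<Prod>j\<in>{1..4} - {i}. Polynomial.smult (c i j) [:z i j, y i j:])"
      unfolding atiyah_poly_def using assms[of i] that by (intro prod.cong) auto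
    then show ?thesis by (simp only: atiyah_poly_def s_def prod_smult)
  qed
  have "{1..4} = {1, 2, 3, 4::nat}" by auto
  then have prod: "(\<Prod>i\<in>{1..4}. s i) = s 1 * s 2 * s 3 * s 4"
    by (simp add: mult_ac)
  have rows: "atiyah_poly \<alpha> \<beta> 1 = Polynomial.smult (s 1) (atiyah_poly y z 1)"
    "atiyah_poly \<alpha> \<beta> 2 = Polynomial.smult (s 2) (atiyah_poly y z 2)"
    "atiyah_poly \<alpha> \<beta> 3 = Polynomial.smult (s 3) (atiyah_poly y z 3)"
    "atiyah_poly \<alpha> \<beta> 4 = Polynomial.smult (s 4) (atiyah_poly y z 4)"
    by (rule row, simp)+
  have idx: "0 + 1 = (1::nat)" "1 + 1 = (2::nat)" "2 + 1 = (3::nat)" "3 + 1 = (4::nat)" by simp_all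
  show ?thesis
    unfolding s_def[symmetric] prod det_mat_4
    by (simp only: prod.case idx rows coeff_smult) (simp only: algebra_simps)
qed

section \<open>Evaluation for vertices on the coordinate axes\<close>

text \<open>The pairs are, up to scalars, the forms for the vertices (a,0,0), (0,b,0) or its mirror
  image, (0,0,c) and the origin: \<open>(y, z)\<close> is proportional to (1 - height, - planar) of
  the edge direction. Reversed pairs are \<open>(- cnj z, cnj y)\<close> for real lengths and
  \<open>cnj \<mu> = - \<mu>\<close>.\<close>

lemma atiyah_det_explicit:
  fixes a b c p q r \<mu> :: complex
  assumes rel: "p * p = a * a + b * b" "q * q = a * a + c * c" "r * r = b * b + c * c" "\<mu> * \<mu> = -1"
    and yz: "y 1 2 = p" "z 1 2 = a - \<mu> * b" "y 1 3 = q - c" "z 1 3 = a" "y 2 3 = r - c" "z 2 3 = \<mu> * b"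
      "y 1 4 = 1" "z 1 4 = 1" "y 2 4 = 1" "z 2 4 = \<mu>" "y 3 4 = 1" "z 3 4 = 0"
      "y 2 1 = - (a + \<mu> * b)" "z 2 1 = p" "y 3 1 = - a" "z 3 1 = q - c" "y 3 2 = \<mu> * b" "z 3 2 = r - c"
      "y 4 1 = - 1" "z 4 1 = 1" "y 4 2 = \<mu>" "z 4 2 = 1" "y 4 3 = 0" "z 4 3 = 1"
  shows "det (mat 4 4 (\<lambda>(i, j). coeff (atiyah_poly y z (i + 1)) j)) =
    2 * p * (q - c) * (r - c) *
    ((a + b) * (b + c) * (c + a) + r * a * (2 * a + b + c) + q * b * (2 * b + a + c) + p * c * (2 * c + a + b)
      + 2 * ((b + c) * p * q + (a + c) * p * r + (a + b) * q * r) + 6 * p * q * r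
      + \<mu> * (a*b*q - a*b*r - a*c*p + a*c*r + a*p*r - a*q*r + b*c*p - b*c*q - b*p*q + b*q*r + c*p*q - c*p*r))"
proof -
  \<comment> \<open>These names keep the matrix entries short until the final expansion.\<close>
  define u v Q R where "u = a - \<mu> * b" "v = a + \<mu> * b" "Q = q - c" "R = r - c"
  note defs = this
  have idx: "0 + 1 = (1::nat)" "1 + 1 = (2::nat)" "2 + 1 = (3::nat)" "3 + 1 = (4::nat)" by simp_all
  \<comment> \<open>Ring normalisation nests products to the right, so the square relations are also
    needed with a trailing factor.\<close>
  have rel': "p * (p * x) = (a * a + b * b) * x" "q * (q * x) = (a * a + c * c) * x"
    "r * (r * x) = (b * b + c * c) * x" "\<mu> * (\<mu> * x) = - x" for x
    using rel by (simp_all flip: mult.assoc)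
  have 1: "coeff (atiyah_poly y z 1) 0 = u * a"
    "coeff (atiyah_poly y z 1) 1 = u * a + p * a + u * Q"
    "coeff (atiyah_poly y z 1) 2 = p * Q + p * a + u * Q"
    "coeff (atiyah_poly y z 1) 3 = p * Q"
    unfolding atiyah_poly_simps coeff_cubic yz defs[symmetric] by (simp_all add: algebra_simps)
  have 2: "coeff (atiyah_poly y z 2) 0 = - (p * b)"
    "coeff (atiyah_poly y z 2) 1 = p * \<mu> * b + \<mu> * p * R + v * b"
    "coeff (atiyah_poly y z 2) 2 = - (v * \<mu> * b) + p * R - \<mu> * v * R"
    "coeff (atiyah_poly y z 2) 3 = - (v * R)"
    unfolding atiyah_poly_simps coeff_cubic yz defs[symmetric]
    by (simp_all add: algebra_simps rel(4) rel'(4))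
  have 3: "coeff (atiyah_poly y z 3) 0 = 0"
    "coeff (atiyah_poly y z 3) 1 = Q * R"
    "coeff (atiyah_poly y z 3) 2 = Q * \<mu> * b - a * R"
    "coeff (atiyah_poly y z 3) 3 = - (a * \<mu> * b)"
    unfolding atiyah_poly_simps coeff_cubic yz defs[symmetric] by (simp_all add: algebra_simps)
  have 4: "coeff (atiyah_poly y z 4) 0 = 1"
    "coeff (atiyah_poly y z 4) 1 = \<mu> - 1"
    "coeff (atiyah_poly y z 4) 2 = - \<mu>"
    "coeff (atiyah_poly y z 4) 3 = 0"
    unfolding atiyah_poly_simps coeff_cubic yz by (simp_all add: algebra_simps)
  show ?thesis
    unfolding det_mat_4 prod.case idx 1 2 3 4 defs
    by (simp add: algebra_simps rel rel')
qed

text \<open>Count multiples of \<open>p * q * r\<close>. The product of the three leg sums gives 1.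
  Since 2a + b + c is at least p + q, and similarly for the others, the next three terms dominate
  pq(b + c) + pr(a + c) + qr(a + b), which gives 3; its double gives 6, and the last term gives
  6.\<close>

lemma atiyah_inequality:
  fixes a b c p q r :: real
  assumes pos: "a > 0" "b > 0" "c > 0" "p > 0" "q > 0" "r > 0"
    and rel: "p\<^sup>2 = a\<^sup>2 + b\<^sup>2" "q\<^sup>2 = a\<^sup>2 + c\<^sup>2" "r\<^sup>2 = b\<^sup>2 + c\<^sup>2"
  shows "16 * p * q * r \<le> (a + b) * (b + c) * (c + a)
      + r * a * (2 * a + b + c) + q * b * (2 * b + a + c) + p * c * (2 * c + a + b)
      + 2 * ((b + c) * p * q + (a + c) * p * r + (a + b) * q * r) + 6 * p * q * r"
proof -
  have leg_sum: "z \<le> x + y" if "z\<^sup>2 = x\<^sup>2 + y\<^sup>2" "x > 0" "y > 0" for x y z :: real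
    by (rule power2_le_imp_le) (use that in \<open>simp_all add: power2_sum\<close>)
  have p: "p \<le> a + b" and q: "q \<le> c + a" and r: "r \<le> b + c"
    using leg_sum rel pos by (simp_all add: add.commute)
  have pr: "p * (q * r) \<le> (a + b) * (q * r)" "q * (p * r) \<le> (c + a) * (p * r)" "r * (p * q) \<le> (b + c) * (p * q)"
    using pos p q r by simp_all
  have 0: "p * q * r \<le> (a + b) * (c + a) * (b + c)"
    using pos p q r by (intro mult_mono) simp_all
  have 1: "(r * a) * (p + q) \<le> (r * a) * ((a + b) + (c + a))"
    using pos p q r by (intro mult_left_mono) simp_all
  have 2: "(q * b) * (p + r) \<le> (q * b) * ((a + b) + (b + c))"
    using pos p q r by (intro mult_left_mono) simp_all
  have 3: "(p * c) * (q + r) \<le> (p * c) * ((c + a) + (b + c))"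
    using pos p q r by (intro mult_left_mono) simp_all
  show ?thesis
    using 0 1 2 3 pr unfolding distrib_left distrib_right by (simp add: mult_ac)
qed

section \<open>A frame adapted to three orthogonal edges\<close>

text \<open>Take the unit form whose root is the antipode \<open>- u\<close>. Its projector then has
  \<open>u\<close> as third axis, and the height of \<open>u\<close> becomes
  \<open>inner u u\<close>.\<close>

lemma exists_unit_form_height:
  assumes "norm (u :: real ^ 3) = 1"
  shows "\<exists>g h. g * cnj g + h * cnj h = 1 \<and> height g h u = 1"
proof -
  have u: "norm (- u) = 1" using assms by simp
  obtain g h where n: "(cmod g)\<^sup>2 + (cmod h)\<^sup>2 = 1" and root: "form_root g h (stereo (- u))"
    using form_root_unit_exists by blast
  have gh: "g * cnj g + h * cnj h = 1"
    using n by (simp only: complex_norm_square[symmetric] of_real_add[symmetric] of_real_1)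
  define W where "W = Complex (u $ 1) (u $ 2)"
  define s where "s = complex_of_real (u $ 3)"
  have 1: "2 * (g * cnj g) = 1 + s" "2 * (h * cnj h) = 1 - s" "2 * (h * cnj g) = W"
    using form_projector[OF u n root] by (simp_all add: s_def W_def complex_eq_iff)
  have 2: "2 * (g * cnj h) = cnj W"
    using arg_cong[OF 1(3), of cnj] by (simp add: mult_ac)
  have "2 * of_real (height g h u) =
      s * (2 * (g * cnj g) - 2 * (h * cnj h)) + (2 * (g * cnj h)) * W + (2 * (h * cnj g)) * cnj W"
    unfolding of_real_height s_def W_def by (simp add: algebra_simps)
  also have "\<dots> = 2 * (s * s + W * cnj W)"
    unfolding 1 2 by (simp add: algebra_simps)
  also have "s * s + W * cnj W = of_real (inner u u)"
    by (simp add: s_def W_def inner_vec_def sum_3 complex_eq_iff algebra_simps)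
  also have "inner u u = 1" using assms by (simp add: norm_eq_1)
  finally have "height g h u = 1" by simp
  with gh show ?thesis by blast
qed

lemma height_scaleR: "height g h (k *\<^sub>R d) = k * height g h d"
  by (simp add: height_def algebra_simps)

lemma planar_scaleR: "planar g h (k *\<^sub>R d) = of_real k * planar g h d"
  by (simp add: planar_def algebra_simps complex_eq_iff)

text \<open>Rotate \<open>d\<^sub>3\<close> to the third axis; orthogonality puts the other two
  vectors in the plane. A phase then turns \<open>d\<^sub>1\<close> to the positive real axis, so
  \<open>d\<^sub>2\<close> is imaginary. The sign of \<open>\<mu>\<close> is the orientation, which
  no rotation changes.\<close>

lemma orthogonal_frame:
  fixes d\<^sub>1 d\<^sub>2 d\<^sub>3 :: "real ^ 3"
  assumes nz: "d\<^sub>1 \<noteq> 0" "d\<^sub>2 \<noteq> 0" "d\<^sub>3 \<noteq> 0"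
    and orth: "inner d\<^sub>1 d\<^sub>2 = 0" "inner d\<^sub>1 d\<^sub>3 = 0" "inner d\<^sub>2 d\<^sub>3 = 0"
  obtains g h \<mu> where "g * cnj g + h * cnj h = 1" "\<mu> = \<i> \<or> \<mu> = - \<i>"
    "height g h d\<^sub>1 = 0" "height g h d\<^sub>2 = 0" "height g h d\<^sub>3 = norm d\<^sub>3"
    "planar g h d\<^sub>1 = of_real (norm d\<^sub>1)" "planar g h d\<^sub>2 = \<mu> * of_real (norm d\<^sub>2)" "planar g h d\<^sub>3 = 0"
proof -
  have "norm (d\<^sub>3 /\<^sub>R norm d\<^sub>3) = 1" using nz by simp
  then obtain g h where gh: "g * cnj g + h * cnj h = 1" and 1: "height g h (d\<^sub>3 /\<^sub>R norm d\<^sub>3) = 1"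
    using exists_unit_form_height by blast
  have N3: "height g h d\<^sub>3 = norm d\<^sub>3"
    using 1 nz by (simp add: height_scaleR field_simps)
  \<comment> \<open>General in \<open>g\<close> and \<open>h\<close>, because it is applied again
    after the turn by \<open>\<psi>\<close>.\<close>
  have sq: "(norm d)\<^sup>2 = (height g h d)\<^sup>2 + (cmod (planar g h d))\<^sup>2" if "g * cnj g + h * cnj h = 1" for g h d
    using inner_height_planar[OF that, of d d]
    by (simp add: power2_norm_eq_inner power2_eq_square[of "height g h d"] flip: complex_norm_square)
  have L3: "planar g h d\<^sub>3 = 0"
    using sq[OF gh, of d\<^sub>3] N3 by simp
  have N: "height g h d\<^sub>1 = 0" "height g h d\<^sub>2 = 0"
    using inner_height_planar[OF gh, of _ d\<^sub>3] orth nz L3 N3 by auto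
  have cL1: "cmod (planar g h d\<^sub>1) = norm d\<^sub>1"
    using sq[OF gh, of d\<^sub>1] N by simp
  \<comment> \<open>\<open>planar\<close> is quadratic in \<open>(g, h)\<close>, so the phase of the
    turn must be halved.\<close>
  define \<psi> where "\<psi> = csqrt (cnj (planar g h d\<^sub>1) / of_real (norm d\<^sub>1))"
  have \<psi>2: "\<psi>\<^sup>2 = cnj (planar g h d\<^sub>1) / of_real (norm d\<^sub>1)" by (simp add: \<psi>_def)
  have "(cmod \<psi>)\<^sup>2 = 1"
    using nz cL1 by (simp add: \<psi>2 norm_divide flip: norm_power)
  then have "cmod \<psi> = 1"
    by (metis abs_norm_cancel abs_square_eq_1)
  then have c\<psi>: "cmod \<psi> = 1" "\<psi> * cnj \<psi> = 1"
    by (simp_all flip: complex_norm_square)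
  have height: "height (\<psi> * g) (\<psi> * h) d = height g h d" for d
  proof -
    have "(\<psi> * g) * cnj (\<psi> * h) = g * cnj h * (\<psi> * cnj \<psi>)" by simp
    then show ?thesis
      unfolding height_def by (simp only: norm_mult c\<psi>) simp
  qed
  have planar: "planar (\<psi> * g) (\<psi> * h) d = \<psi>\<^sup>2 * planar g h d" for d
    by (simp add: planar_def power2_eq_square algebra_simps)
  have gh': "(\<psi> * g) * cnj (\<psi> * g) + (\<psi> * h) * cnj (\<psi> * h) = 1"
  proof -
    have "(\<psi> * g) * cnj (\<psi> * g) + (\<psi> * h) * cnj (\<psi> * h) = (\<psi> * cnj \<psi>) * (g * cnj g + h * cnj h)"
      by (simp add: algebra_simps)
    then show ?thesis by (simp add: c\<psi>(2) gh)
  qed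
  have "planar (\<psi> * g) (\<psi> * h) d\<^sub>1 = planar g h d\<^sub>1 * cnj (planar g h d\<^sub>1) / of_real (norm d\<^sub>1)"
    by (simp add: planar \<psi>2)
  then have L1: "planar (\<psi> * g) (\<psi> * h) d\<^sub>1 = of_real (norm d\<^sub>1)"
    using nz cL1 by (simp add: power2_eq_square flip: complex_norm_square)
  define \<mu> where "\<mu> = planar (\<psi> * g) (\<psi> * h) d\<^sub>2 / of_real (norm d\<^sub>2)"
  have "Re (planar (\<psi> * g) (\<psi> * h) d\<^sub>2) = 0"
    using inner_height_planar[OF gh', of d\<^sub>1 d\<^sub>2] orth N L1 nz by (simp add: height)
  moreover have "cmod (planar (\<psi> * g) (\<psi> * h) d\<^sub>2) = norm d\<^sub>2"
    using sq[OF gh', of d\<^sub>2] N by (simp add: height)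
  ultimately have "Re \<mu> = 0" "cmod \<mu> = 1"
    using nz by (simp_all add: \<mu>_def norm_divide)
  then have "\<mu> = \<i> \<or> \<mu> = - \<i>"
    by (auto simp: complex_eq_iff cmod_def abs_if split: if_splits)
  moreover have "planar (\<psi> * g) (\<psi> * h) d\<^sub>2 = \<mu> * of_real (norm d\<^sub>2)"
    using nz by (simp add: \<mu>_def)
  ultimately show ?thesis
    using that[OF gh'] N N3 L1 L3 by (simp add: height planar)
qed

section \<open>The determinant in the adapted frame\<close>

text \<open>Here \<open>y\<close> and \<open>z\<close> are the coordinates of
  \<open>(\<alpha>, \<beta>)\<close> in the basis \<open>(g, h)\<close>,
  \<open>(- cnj h, cnj g)\<close>; the projector entries transform accordingly.\<close>

lemma form_projector_frame:
  fixes u :: "real ^ 3"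
  assumes u: "norm u = 1" and n: "(cmod \<alpha>)\<^sup>2 + (cmod \<beta>)\<^sup>2 = 1"
    and root: "form_root \<alpha> \<beta> (stereo u)" and gh: "g * cnj g + h * cnj h = 1"
  defines "y \<equiv> cnj g * \<alpha> + cnj h * \<beta>" and "z \<equiv> g * \<beta> - h * \<alpha>"
  shows "2 * (y * cnj y) = 1 - of_real (height g h u)" "2 * (z * cnj y) = - planar g h u"
proof -
  define W where "W = Complex (u $ 1) (u $ 2)"
  define s where "s = complex_of_real (u $ 3)"
  have 1: "2 * (\<alpha> * cnj \<alpha>) = 1 - s" "2 * (\<beta> * cnj \<beta>) = 1 + s" "2 * (\<beta> * cnj \<alpha>) = - W"
    using form_projector[OF u n root] by (simp_all add: s_def W_def)
  have 2: "2 * (\<alpha> * cnj \<beta>) = - cnj W"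
    using arg_cong[OF 1(3), of cnj] by (simp add: mult_ac)
  have "2 * (y * cnj y) = g * cnj g * (2 * (\<alpha> * cnj \<alpha>)) + h * cnj h * (2 * (\<beta> * cnj \<beta>))
      + cnj g * h * (2 * (\<alpha> * cnj \<beta>)) + g * cnj h * (2 * (\<beta> * cnj \<alpha>))"
    by (simp add: y_def algebra_simps)
  also have "\<dots> = (g * cnj g + h * cnj h) - of_real (height g h u)"
    unfolding 1 2 of_real_height s_def[symmetric] W_def[symmetric] by (simp add: algebra_simps)
  finally show "2 * (y * cnj y) = 1 - of_real (height g h u)" by (simp only: gh)
  have "2 * (z * cnj y) = g\<^sup>2 * (2 * (\<beta> * cnj \<alpha>)) - h\<^sup>2 * (2 * (\<alpha> * cnj \<beta>))
      + g * h * (2 * (\<beta> * cnj \<beta>) - 2 * (\<alpha> * cnj \<alpha>))"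
    by (simp add: y_def z_def algebra_simps power2_eq_square)
  also have "\<dots> = - planar g h u"
    unfolding 1 2 planar_def s_def[symmetric] W_def[symmetric] by (simp add: algebra_simps)
  finally show "2 * (z * cnj y) = - planar g h u" .
qed

text \<open>The vector \<open>(y, z)\<close> is parallel to its multiple by \<open>cnj y\<close>,
  hence to \<open>(k, l)\<close>. The normalisation fixes only the modulus of the factor
  \<open>c\<close>.\<close>

lemma proportional_pair:
  fixes y z k l m :: complex
  assumes "m * (y * cnj y) = k" "m * (z * cnj y) = l" "k \<noteq> 0" "cnj k = k"
  obtains c where "y = c * k" "z = c * l" "m * k * (c * cnj c) = 1"
proof
  have y: "y \<noteq> 0" "m \<noteq> 0" using assms by auto
  show "y = y / k * k" using assms by simp
  have "m * cnj y * (z * k) = m * cnj y * (y * l)"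
    unfolding assms(1,2)[symmetric] by simp
  then have "z * k = y * l" using y by simp
  then show "z = y / k * l" using assms(3) by (simp add: field_simps)
  have "m * k * (y / k * cnj (y / k)) = m * (y * cnj y) / k"
    using assms(3,4) by simp
  then show "m * k * (y / k * cnj (y / k)) = 1" using assms(1,3) by simp
qed

text \<open>Pull a scalar out of every form and evaluate explicitly. Opposite forms carry conjugate
  scalars, so only squared moduli enter; these are known and turn the prefactor 2p(q - c)(r - c)
  into 1/(16pqr).\<close>

lemma atiyah_det_frame:
  fixes a b c p q r :: real and \<mu> :: complex
  assumes pos: "a > 0" "b > 0" "c > 0" "p > 0" "q > 0" "r > 0"
    and rel: "p\<^sup>2 = a\<^sup>2 + b\<^sup>2" "q\<^sup>2 = a\<^sup>2 + c\<^sup>2" "r\<^sup>2 = b\<^sup>2 + c\<^sup>2"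
    and \<mu>: "\<mu> = \<i> \<or> \<mu> = - \<i>"
    and yz: "2 * of_real p * (y 1 2 * cnj (y 1 2)) = of_real p"
      "2 * of_real p * (z 1 2 * cnj (y 1 2)) = of_real a - \<mu> * of_real b"
      "2 * of_real q * (y 1 3 * cnj (y 1 3)) = of_real q - of_real c"
      "2 * of_real q * (z 1 3 * cnj (y 1 3)) = of_real a"
      "2 * of_real r * (y 2 3 * cnj (y 2 3)) = of_real r - of_real c"
      "2 * of_real r * (z 2 3 * cnj (y 2 3)) = \<mu> * of_real b"
      "2 * (y 1 4 * cnj (y 1 4)) = 1" "2 * (z 1 4 * cnj (y 1 4)) = 1"
      "2 * (y 2 4 * cnj (y 2 4)) = 1" "2 * (z 2 4 * cnj (y 2 4)) = \<mu>"
      "1 * (y 3 4 * cnj (y 3 4)) = 1" "1 * (z 3 4 * cnj (y 3 4)) = 0"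
    and J: "\<And>i j. i \<in> {1..4} \<Longrightarrow> j \<in> {1..4} \<Longrightarrow> i < j \<Longrightarrow> y j i = - cnj (z i j) \<and> z j i = cnj (y i j)"
  shows "16 * p * q * r * Re (det (mat 4 4 (\<lambda>(i, j). coeff (atiyah_poly y z (i + 1)) j))) =
    (a + b) * (b + c) * (c + a) + r * a * (2 * a + b + c) + q * b * (2 * b + a + c) + p * c * (2 * c + a + b)
      + 2 * ((b + c) * p * q + (a + c) * p * r + (a + b) * q * r) + 6 * p * q * r"
    (is "_ = ?S")
proof -
  have \<mu>': "\<mu> * \<mu> = - 1" "cnj \<mu> = - \<mu>" using \<mu> by auto
  have "c < q" "c < r"
    by (rule power2_less_imp_less; use rel pos in simp)+
  then have nz: "complex_of_real p \<noteq> 0" "complex_of_real q - c \<noteq> 0" "complex_of_real r - c \<noteq> 0"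
    using pos by (simp_all flip: of_real_diff)
  obtain l12 :: complex where l12: "y 1 2 = l12 * of_real p" "z 1 2 = l12 * (of_real a - \<mu> * of_real b)"
      "2 * of_real p * of_real p * (l12 * cnj l12) = 1"
    by (rule proportional_pair[OF yz(1,2) nz(1)]) simp
  obtain l13 :: complex where l13: "y 1 3 = l13 * (of_real q - of_real c)" "z 1 3 = l13 * of_real a"
      "2 * of_real q * (of_real q - of_real c) * (l13 * cnj l13) = 1"
    by (rule proportional_pair[OF yz(3,4) nz(2)]) simp
  obtain l23 :: complex where l23: "y 2 3 = l23 * (of_real r - of_real c)" "z 2 3 = l23 * (\<mu> * of_real b)"
      "2 * of_real r * (of_real r - of_real c) * (l23 * cnj l23) = 1"
    by (rule proportional_pair[OF yz(5,6) nz(3)]) simp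
  obtain l14 where l14: "y 1 4 = l14 * 1" "z 1 4 = l14 * 1" "2 * 1 * (l14 * cnj l14) = 1"
    by (rule proportional_pair[OF yz(7,8)]) simp_all
  obtain l24 where l24: "y 2 4 = l24 * 1" "z 2 4 = l24 * \<mu>" "2 * 1 * (l24 * cnj l24) = 1"
    by (rule proportional_pair[OF yz(9,10)]) simp_all
  \<comment> \<open>The edge from \<open>x 3\<close> to \<open>x 4\<close> points down the third
    axis: 1 - height is 2, hence the factor 1 in place of 2.\<close>
  obtain l34 where l34: "y 3 4 = l34 * 1" "z 3 4 = l34 * 0" "1 * 1 * (l34 * cnj l34) = 1"
    by (rule proportional_pair[OF yz(11,12)]) simp_all
  \<comment> \<open>The default branches return nonzero scalars, so \<open>s\<close> never vanishes,
    even on the diagonal, and division by it is safe.\<close>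
  define l where "l i j = (if i = 1 then if j = 2 then l12 else if j = 3 then l13 else l14
      else if i = 2 then if j = 3 then l23 else l24 else l34)" for i j :: nat
  define s where "s i j = (if i < j then l i j else cnj (l j i))" for i j
  define y0 z0 where "y0 i j = y i j / s i j" and "z0 i j = z i j / s i j" for i j
  have l_simps: "s 1 2 = l12" "s 1 3 = l13" "s 1 4 = l14" "s 2 3 = l23" "s 2 4 = l24" "s 3 4 = l34"
    "s 2 1 = cnj l12" "s 3 1 = cnj l13" "s 4 1 = cnj l14" "s 3 2 = cnj l23" "s 4 2 = cnj l24" "s 4 3 = cnj l34"
    by (simp_all add: s_def l_def)
  have l_nz: "l12 \<noteq> 0" "l13 \<noteq> 0" "l14 \<noteq> 0" "l23 \<noteq> 0" "l24 \<noteq> 0" "l34 \<noteq> 0"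
    using l12(3) l13(3) l14(3) l23(3) l24(3) l34(3) by auto
  have s_nz: "s i j \<noteq> 0" for i j
    using l_nz by (simp add: s_def l_def)
  have yJ: "y 2 1 = - cnj (z 1 2)" "z 2 1 = cnj (y 1 2)" "y 3 1 = - cnj (z 1 3)" "z 3 1 = cnj (y 1 3)"
    "y 4 1 = - cnj (z 1 4)" "z 4 1 = cnj (y 1 4)" "y 3 2 = - cnj (z 2 3)" "z 3 2 = cnj (y 2 3)"
    "y 4 2 = - cnj (z 2 4)" "z 4 2 = cnj (y 2 4)" "y 4 3 = - cnj (z 3 4)" "z 4 3 = cnj (y 3 4)"
    using J[of 1 2] J[of 1 3] J[of 1 4] J[of 2 3] J[of 2 4] J[of 3 4] by simp_all
  let ?T = "a*b*q - a*b*r - a*c*p + a*c*r + a*p*r - a*q*r + b*c*p - b*c*q - b*p*q + b*q*r + c*p*q - c*p*r"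
  have "det (mat 4 4 (\<lambda>(i, j). coeff (atiyah_poly y0 z0 (i + 1)) j)) =
    2 * of_real p * (of_real q - of_real c) * (of_real r - of_real c) * (of_real ?S + \<mu> * of_real ?T)"
    unfolding of_real_add of_real_mult of_real_diff of_real_numeral
  proof (rule atiyah_det_explicit)
    show "of_real p * of_real p = (of_real a * of_real a + of_real b * of_real b :: complex)"
      "of_real q * of_real q = (of_real a * of_real a + of_real c * of_real c :: complex)"
      "of_real r * of_real r = (of_real b * of_real b + of_real c * of_real c :: complex)"
      using rel unfolding power2_eq_square by (simp_all only: flip: of_real_mult of_real_add)
    show "\<mu> * \<mu> = - 1" by fact
  qed (simp_all only: y0_def z0_def l_simps yJ l12 l13 l14 l23 l24 l34,
       simp_all add: l_nz \<mu>')
  moreover have "det (mat 4 4 (\<lambda>(i, j). coeff (atiyah_poly y z (i + 1)) j)) =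
      (\<Prod>i\<in>{1..4}. \<Prod>j\<in>{1..4} - {i}. s i j) *
      det (mat 4 4 (\<lambda>(i, j). coeff (atiyah_poly y0 z0 (i + 1)) j))"
    by (rule atiyah_det_scale) (simp add: y0_def z0_def s_nz)
  moreover have "(\<Prod>i\<in>{1..4}. \<Prod>j\<in>{1..4} - {i}. s i j) =
      (l12 * cnj l12) * (l13 * cnj l13) * (l14 * cnj l14) * (l23 * cnj l23) * (l24 * cnj l24) * (l34 * cnj l34)"
  proof -
    have "{1..4} = {1, 2, 3, 4::nat}" by auto
    then have "(\<Prod>i\<in>{1..4}. f i) = f 1 * f 2 * f 3 * f 4" for f :: "nat \<Rightarrow> complex"
      by (simp add: mult_ac)
    then show ?thesis by (simp only: minus_1_to_4) (simp add: l_simps[simplified] mult_ac)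
  qed
  \<comment> \<open>Grouped so that each of the six factors containing a squared modulus equals
    1.\<close>
  ultimately have "16 * of_real p * of_real q * of_real r * det (mat 4 4 (\<lambda>(i, j). coeff (atiyah_poly y z (i + 1)) j)) =
      (2 * of_real p * of_real p * (l12 * cnj l12)) * (2 * of_real q * (of_real q - of_real c) * (l13 * cnj l13)) * (2 * 1 * (l14 * cnj l14))
      * (2 * of_real r * (of_real r - of_real c) * (l23 * cnj l23)) * (2 * 1 * (l24 * cnj l24)) * (1 * 1 * (l34 * cnj l34))
      * (of_real ?S + \<mu> * of_real ?T)"
    by (simp only: mult_ac) simp
  then have "of_real (16 * p * q * r) * det (mat 4 4 (\<lambda>(i, j). coeff (atiyah_poly y z (i + 1)) j)) =
      of_real ?S + \<mu> * of_real ?T"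
    unfolding l12(3) l13(3) l14(3) l23(3) l24(3) l34(3) by simp
  \<comment> \<open>\<open>\<mu>\<close> is purely imaginary, so \<open>?T\<close> contributes
    nothing to the real part.\<close>
  moreover have "Re (of_real ?S + \<mu> * of_real ?T) = ?S"
    using \<mu> by auto
  moreover have "Re (of_real k * w) = k * Re w" for k w by simp
  ultimately show ?thesis by metis
qed


section \<open>Trirectangular tetrahedra\<close>

lemma dist_prod_eq:
  "dist_prod x = dist (x 1) (x 4) * dist (x 2) (x 4) * dist (x 3) (x 4) *
    (dist (x 1) (x 2) * dist (x 1) (x 3) * dist (x 2) (x 3))"
proof -
  have "{1..4} = {1, 2, 3, 4::nat}" "{1..<2} = {1::nat}" "{1..<3} = {1, 2::nat}" "{1..<4} = {1, 2, 3::nat}"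
    by auto
  then show ?thesis by (simp add: dist_prod_def)
qed

theorem mainTheorem5:
  fixes x :: "nat \<Rightarrow> real ^ 3"
    and \<alpha> \<beta> :: "nat \<Rightarrow> nat \<Rightarrow> complex"
  assumes "trirectangular x"
    and "admissible_forms x \<alpha> \<beta>"
  shows "Re (atiyah_D4 x \<alpha> \<beta>) \<ge> 64 * dist_prod x \<and>
         cmod (atiyah_D4 x \<alpha> \<beta>) \<ge> 64 * dist_prod x"
proof -
  have distinct: "x i \<noteq> x j" if "i \<in> {1..4}" "j \<in> {1..4}" "i < j" for i j
    using assms(1) that unfolding trirectangular_def inj_on_def by (metis less_irrefl)
  have orth: "inner (x i - x 4) (x j - x 4) = 0" if "i \<in> {1..3}" "j \<in> {1..3}" "i < j" for i j
    using assms(1) that by (simp add: trirectangular_def Linear_Algebra.orthogonal_def)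
  have nz: "x 1 - x 4 \<noteq> 0" "x 2 - x 4 \<noteq> 0" "x 3 - x 4 \<noteq> 0"
    using distinct by simp_all
  obtain g h \<mu> where gh: "g * cnj g + h * cnj h = 1" and \<mu>: "\<mu> = \<i> \<or> \<mu> = - \<i>"
    and N: "height g h (x 1 - x 4) = 0" "height g h (x 2 - x 4) = 0" "height g h (x 3 - x 4) = norm (x 3 - x 4)"
    and L: "planar g h (x 1 - x 4) = of_real (norm (x 1 - x 4))"
      "planar g h (x 2 - x 4) = \<mu> * of_real (norm (x 2 - x 4))" "planar g h (x 3 - x 4) = 0"
    by (rule orthogonal_frame[OF nz]) (use orth in simp_all)
  \<comment> \<open>With \<open>x 4\<close> as origin, the edges ending there fit the same formulas
    as the others.\<close>
  have NL4: "height g h (x 4 - x 4) = 0" "planar g h (x 4 - x 4) = 0"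
    by (simp_all add: height_def planar_def complex_eq_iff)
  define a b c p q r where "a = dist (x 1) (x 4)" "b = dist (x 2) (x 4)" "c = dist (x 3) (x 4)"
    "p = dist (x 1) (x 2)" "q = dist (x 1) (x 3)" "r = dist (x 2) (x 3)"
  note defs = this
  have pos: "a > 0" "b > 0" "c > 0" "p > 0" "q > 0" "r > 0"
    unfolding defs using distinct by simp_all
  have "(dist (x i) (x j))\<^sup>2 = (dist (x i) (x 4))\<^sup>2 + (dist (x j) (x 4))\<^sup>2"
    if "i \<in> {1..3}" "j \<in> {1..3}" "i < j" for i j
  proof -
    have "x i - x j = (x i - x 4) - (x j - x 4)" by simp
    then show ?thesis
      using orth[OF that] by (simp only: dist_norm power2_norm_eq_inner inner_diff inner_commute)
  qed
  then have rel: "p\<^sup>2 = a\<^sup>2 + b\<^sup>2" "q\<^sup>2 = a\<^sup>2 + c\<^sup>2" "r\<^sup>2 = b\<^sup>2 + c\<^sup>2"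
    unfolding defs by simp_all
  \<comment> \<open>Coordinates of the forms in the rotated basis; \<open>gh\<close> makes the basis
    unimodular and lets \<open>\<alpha>\<close> and \<open>\<beta>\<close> be recovered.\<close>
  define y z where "y i j = cnj g * \<alpha> i j + cnj h * \<beta> i j" and "z i j = g * \<beta> i j - h * \<alpha> i j" for i j
  have \<alpha>: "\<alpha> i j = y i j * g + z i j * - cnj h" and \<beta>: "\<beta> i j = y i j * h + z i j * cnj g" for i j
  proof -
    have "y i j * g + z i j * - cnj h = (g * cnj g + h * cnj h) * \<alpha> i j"
      "y i j * h + z i j * cnj g = (g * cnj g + h * cnj h) * \<beta> i j"
      by (simp_all add: y_def z_def algebra_simps)
    then show "\<alpha> i j = y i j * g + z i j * - cnj h" "\<beta> i j = y i j * h + z i j * cnj g"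
      by (simp_all only: gh mult_1_left)
  qed
  \<comment> \<open>Multiplying by the edge length clears the denominator of
    \<open>direction\<close>; linearity reduces everything to the three edges at
    \<open>x 4\<close>.\<close>
  have yz: "2 * of_real (dist (x i) (x j)) * (y i j * cnj (y i j)) =
        of_real (dist (x i) (x j) - (height g h (x j - x 4) - height g h (x i - x 4)))"
      "2 * of_real (dist (x i) (x j)) * (z i j * cnj (y i j)) =
        planar g h (x i - x 4) - planar g h (x j - x 4)"
    if ij: "i \<in> {1..4}" "j \<in> {1..4}" "i < j" for i j
  proof -
    define d where "d = dist (x i) (x j)"
    have d: "d > 0" using distinct[OF ij] by (simp add: d_def)
    have "norm (direction x i j) = 1"
      using d by (simp add: direction_def d_def dist_norm norm_minus_commute)
    moreover have "(cmod (\<alpha> i j))\<^sup>2 + (cmod (\<beta> i j))\<^sup>2 = 1"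
      "form_root (\<alpha> i j) (\<beta> i j) (stereo (direction x i j))"
      using assms(2) ij unfolding admissible_forms_def by blast+
    ultimately have "2 * (y i j * cnj (y i j)) = 1 - of_real (height g h (direction x i j))"
      "2 * (z i j * cnj (y i j)) = - planar g h (direction x i j)"
      unfolding y_def z_def using form_projector_frame[OF _ _ _ gh] by blast+
    moreover have "direction x i j = inverse d *\<^sub>R ((x j - x 4) - (x i - x 4))"
      by (simp add: direction_def d_def)
    ultimately have 1: "2 * (y i j * cnj (y i j)) =
        1 - of_real (inverse d * (height g h (x j - x 4) - height g h (x i - x 4)))"
      "2 * (z i j * cnj (y i j)) = - (of_real (inverse d) * (planar g h (x j - x 4) - planar g h (x i - x 4)))"
      by (simp_all only: height_scaleR planar_scaleR height_diff planar_diff)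
    have 2: "2 * of_real d * (y i j * cnj (y i j)) = of_real d * (2 * (y i j * cnj (y i j)))"
      "2 * of_real d * (z i j * cnj (y i j)) = of_real d * (2 * (z i j * cnj (y i j)))" by simp_all
    show "2 * of_real (dist (x i) (x j)) * (y i j * cnj (y i j)) =
        of_real (dist (x i) (x j) - (height g h (x j - x 4) - height g h (x i - x 4)))"
      "2 * of_real (dist (x i) (x j)) * (z i j * cnj (y i j)) =
        planar g h (x i - x 4) - planar g h (x j - x 4)"
      unfolding d_def[symmetric] 2 1 using d by (simp_all add: field_simps)
  qed
  have J: "y j i = - cnj (z i j) \<and> z j i = cnj (y i j)" if "i \<in> {1..4}" "j \<in> {1..4}" "i < j" for i j
  proof -
    have "\<alpha> j i = - cnj (\<beta> i j)" "\<beta> j i = cnj (\<alpha> i j)"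
      using assms(2) that unfolding admissible_forms_def by blast+
    then show ?thesis by (simp add: y_def z_def)
  qed
  define D where "D = det (mat 4 4 (\<lambda>(i, j). coeff (atiyah_poly \<alpha> \<beta> (i + 1)) j))"
  have "D = det (mat 4 4 (\<lambda>(i, j). coeff (atiyah_poly y z (i + 1)) j))"
    unfolding D_def
  proof (rule atiyah_det_change_basis)
    show "g * cnj g - h * - cnj h = 1" using gh by simp
  qed (simp add: \<alpha> \<beta>)
  \<comment> \<open>Cancelling the positive factor \<open>16 * p * q * r\<close> leaves real part at
    least 1 for the normalised determinant.\<close>
  moreover have "16 * p * q * r \<le> 16 * p * q * r *
      Re (det (mat 4 4 (\<lambda>(i, j). coeff (atiyah_poly y z (i + 1)) j)))"
  proof (subst atiyah_det_frame[OF pos rel \<mu> _ _ _ _ _ _ _ _ _ _ _ _ J])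
    have abc: "norm (x 1 - x 4) = a" "norm (x 2 - x 4) = b" "norm (x 3 - x 4) = c"
      by (simp_all add: defs dist_norm)
    show "2 * of_real p * (y 1 2 * cnj (y 1 2)) = of_real p"
      "2 * of_real p * (z 1 2 * cnj (y 1 2)) = of_real a - \<mu> * of_real b"
      "2 * of_real q * (y 1 3 * cnj (y 1 3)) = of_real q - of_real c"
      "2 * of_real q * (z 1 3 * cnj (y 1 3)) = of_real a"
      "2 * of_real r * (y 2 3 * cnj (y 2 3)) = of_real r - of_real c"
      "2 * of_real r * (z 2 3 * cnj (y 2 3)) = \<mu> * of_real b"
      using yz[of 1 2] yz[of 1 3] yz[of 2 3] unfolding N L abc defs[symmetric] by simp_all
    show "2 * (y 1 4 * cnj (y 1 4)) = 1" "2 * (z 1 4 * cnj (y 1 4)) = 1"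
      using yz[of 1 4] pos unfolding N L NL4 abc defs[symmetric] by simp_all
    show "2 * (y 2 4 * cnj (y 2 4)) = 1" "2 * (z 2 4 * cnj (y 2 4)) = \<mu>"
      using yz[of 2 4] pos unfolding N L NL4 abc defs[symmetric] by simp_all
    show "1 * (y 3 4 * cnj (y 3 4)) = 1" "1 * (z 3 4 * cnj (y 3 4)) = 0"
      using yz[of 3 4] pos unfolding N L NL4 abc defs[symmetric] by simp_all
  qed (use atiyah_inequality[OF pos rel] in simp_all)
  ultimately have "Re D \<ge> 1" using pos by simp
  then have "64 * dist_prod x * 1 \<le> 64 * dist_prod x * Re D"
    using pos by (intro mult_left_mono) (simp_all add: dist_prod_eq flip: defs)
  moreover have "atiyah_D4 x \<alpha> \<beta> = of_real (64 * dist_prod x) * D"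
    by (simp add: atiyah_D4_def D_def)
  then have "Re (atiyah_D4 x \<alpha> \<beta>) = 64 * dist_prod x * Re D" by simp
  ultimately have "64 * dist_prod x \<le> Re (atiyah_D4 x \<alpha> \<beta>)" by simp
  then show ?thesis using complex_Re_le_cmod order_trans by blast
qed

end
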